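(* Every $3$-generic finite metric space can be reconstructed from its $q$-spectrum. That is, if $X$ and $X'$ are $3$-generic finite metric spaces having the same $q$-spectrum, then $X$ and $X'$ are isometric.
   Context: Let $(X,d)$ be a finite metric space, $X=\{x_1,\dots,x_n\}$, $d_{ij}=d(x_i,x_j)$. The similarity matrix of $X$ is the $n\times n$ matrix $Z(q)=(q^{d_{ij}})_{i,j}$, where $q$ is a formal parameter (equivalently, $q$ ranges over real numbers in $(0,1)$). The $q$-spectrum of $X$ is the multiset $[\lambda_1(q),\dots,\lambda_n(q)]$ of eigenvalues of $Z(q)$. Two finite metric spaces have the same $q$-spectrum if these multisets agree for all $q\in(0,1)$; equivalently, the characteristic polynomials $|\lambda I-Z(q)|$ coincide, as polynomials in $\lambda$ whose coefficients are generalized polynomials in $q$ (real exponents allowed). The space $X$ is called $3$-generic if the sums of any three distinct pairwise distances are mutually distinct: for any two different $3$-element sets $E\ne E'$ of unordered pairs $\{i,j\}$ with $1\le i<j\le n$, one has $\sum_{\{i,j\}\in E}d_{ij}\neq\sum_{\{i,j\}\in E'}d_{ij}$. *)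

theory Defs
  imports "HOL-Analysis.Abstract_Metric_Spaces" "Jordan_Normal_Form.Char_Poly"
begin

text \<open>
  A finite metric space is a value \<open>X :: 'a metric\<close> together with an enumeration
  \<open>xs\<close> of its points. The points \<open>x\<^sub>1, \<dots>, x\<^sub>n\<close> are \<open>xs ! 0, \<dots>, xs ! (n - 1)\<close>.
\<close>

definition enumerates :: "'a list \<Rightarrow> 'a metric \<Rightarrow> bool" where
  "enumerates xs X \<longleftrightarrow> distinct xs \<and> set xs = mspace X"

text \<open>
  The exponents are real, hence \<open>powr\<close>. For \<open>q > 0\<close> the diagonal entries are \<open>q powr 0 = 1\<close>.
\<close>

definition similarity_matrix :: "'a metric \<Rightarrow> 'a list \<Rightarrow> real \<Rightarrow> real mat" where
  "similarity_matrix X xs q =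
     mat (length xs) (length xs) (\<lambda>(i, j). q powr mdist X (xs ! i) (xs ! j))"

text \<open>
  Eigenvalues are counted with algebraic multiplicity. They are taken in the complex numbers,
  so that the multiset always has as many elements as the matrix has rows.
\<close>

definition eigenvalue_mset :: "real mat \<Rightarrow> complex multiset" where
  "eigenvalue_mset A = proots (char_poly (map_mat complex_of_real A))"

definition q_spectrum :: "'a metric \<Rightarrow> 'a list \<Rightarrow> real \<Rightarrow> complex multiset" where
  "q_spectrum X xs q = eigenvalue_mset (similarity_matrix X xs q)"

text \<open>The unordered pair \<open>{i, j}\<close> is represented by the ordered pair \<open>(i, j)\<close> with \<open>i < j\<close>.\<close>

definition index_pairs :: "nat \<Rightarrow> (nat \<times> nat) set" where
  "index_pairs n = {(i, j). i < j \<and> j < n}"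

definition three_generic :: "'a metric \<Rightarrow> 'a list \<Rightarrow> bool" where
  "three_generic X xs \<longleftrightarrow>
     (\<forall>E E'. E \<subseteq> index_pairs (length xs) \<longrightarrow> card E = 3 \<longrightarrow>
             E' \<subseteq> index_pairs (length xs) \<longrightarrow> card E' = 3 \<longrightarrow> E \<noteq> E' \<longrightarrow>
             (\<Sum>(i, j)\<in>E. mdist X (xs ! i) (xs ! j)) \<noteq> (\<Sum>(i, j)\<in>E'. mdist X (xs ! i) (xs ! j)))"

definition isometric :: "'a metric \<Rightarrow> 'b metric \<Rightarrow> bool" where
  "isometric X Y \<longleftrightarrow>
     (\<exists>f. bij_betw f (mspace X) (mspace Y) \<and>
          (\<forall>x\<in>mspace X. \<forall>y\<in>mspace X. mdist Y (f x) (f y) = mdist X x y))"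

end

theory Submission
  imports Defs "Jordan_Normal_Form.Schur_Decomposition"
begin

text \<open>
  The power sums of the eigenvalues are the traces of powers of \<open>Z(q)\<close>, and finite sums of real
  powers of \<open>q\<close> are determined by their values on \<open>(0, 1)\<close>. Hence the trace of \<open>Z(q)\<^sup>2\<close> gives the
  multiset of distances, that is, a length-preserving bijection \<open>\<phi>\<close> between the edges of the two
  complete graphs, and the trace of \<open>Z(q)\<^sup>3\<close> then gives the multiset of perimeters of triangles. By
  genericity of \<open>X'\<close>, three edges whose lengths add up to the perimeter of a triangle are the sides
  of this triangle, so \<open>\<phi>\<close> maps triangles to triangles. Such a \<open>\<phi>\<close> maps the star of a vertex to
  edges that pairwise intersect but do not form a triangle, hence to a star, and is therefore
  induced by a map of vertices, which is the isometry.
\<close>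

section \<open>Traces of powers and power sums of eigenvalues\<close>

definition trace_mat :: "'a::comm_monoid_add mat \<Rightarrow> 'a" where
  "trace_mat A = (\<Sum>i<dim_row A. A $$ (i, i))"

lemma mat_mult_entry:
  assumes "A \<in> carrier_mat n m" "B \<in> carrier_mat m p" "i < n" "j < p"
  shows "(A * B) $$ (i, j) = (\<Sum>k<m. A $$ (i, k) * B $$ (k, j))"
  using assms by (auto simp: scalar_prod_def lessThan_atLeast0 intro!: sum.cong)

lemma trace_mat_mult:
  assumes "A \<in> carrier_mat n m" "B \<in> carrier_mat m n"
  shows "trace_mat (A * B) = (\<Sum>i<n. \<Sum>j<m. A $$ (i, j) * B $$ (j, i))"
  unfolding trace_mat_def using assms
  by (auto simp: mat_mult_entry[OF assms] simp del: index_mult_mat(1) intro!: sum.cong)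

lemma trace_mat_mult_commute:
  fixes A B :: "'a::comm_semiring_0 mat"
  assumes "A \<in> carrier_mat n m" "B \<in> carrier_mat m n"
  shows "trace_mat (A * B) = trace_mat (B * A)"
  unfolding trace_mat_mult[OF assms] trace_mat_mult[OF assms(2,1)]
  by (subst sum.swap) (simp add: mult.commute)

text \<open>Writing \<open>A\<close> as \<open>P * B * Q\<close> and moving \<open>Q\<close> to the
  front inside the trace leaves \<open>Q * P * B\<close>, where \<open>Q * P\<close> is the
  identity.\<close>

lemma trace_mat_similar:
  fixes A B :: "'a::comm_semiring_1 mat"
  assumes "similar_mat_wit A B P Q"
  shows "trace_mat A = trace_mat B"
proof -
  define n where "n = dim_row A"
  note s = similar_mat_witD[OF n_def assms]
  have "trace_mat A = trace_mat (Q * (P * B))"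
    unfolding s(3) using s by (intro trace_mat_mult_commute[of _ n n]) auto
  also have "Q * (P * B) = B"
    using s assoc_mult_mat[of Q n n P n B n] by simp
  finally show ?thesis .
qed

text \<open>In the sum over \<open>k\<close> for entry \<open>(i, j)\<close> only terms with
  \<open>i \<le> k \<le> j\<close> can be nonzero: none below the diagonal, and only
  \<open>k = i\<close> on it.\<close>

lemma upper_triangular_mult:
  fixes A B :: "'a::semiring_0 mat"
  assumes A: "A \<in> carrier_mat n n" "upper_triangular A"
    and B: "B \<in> carrier_mat n n" "upper_triangular B"
  shows "upper_triangular (A * B)"
    and "i < n \<Longrightarrow> (A * B) $$ (i, i) = A $$ (i, i) * B $$ (i, i)"
proof -
  have z: "A $$ (i, k) * B $$ (k, j) = 0" if "i < n" "k < n" "k < i \<or> j < k" for i j k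
    using that A B by (auto simp: upper_triangular_def)
  show "upper_triangular (A * B)"
  proof (rule upper_triangularI)
    fix i j assume ij: "j < i" "i < dim_row (A * B)"
    with A have "i < n" by simp
    with ij(1) show "(A * B) $$ (i, j) = 0"
      by (subst mat_mult_entry[OF A(1) B(1)]) (auto intro!: sum.neutral z)
  qed
  assume i: "i < n"
  have "(A * B) $$ (i, i) = (\<Sum>k<n. A $$ (i, k) * B $$ (k, i))"
    by (rule mat_mult_entry[OF A(1) B(1) i i])
  also have "\<dots> = (\<Sum>k\<in>{i}. A $$ (i, k) * B $$ (k, i))"
    using i by (intro sum.mono_neutral_right) (auto intro!: z)
  finally show "(A * B) $$ (i, i) = A $$ (i, i) * B $$ (i, i)" by simp
qed

lemma upper_triangular_pow:
  fixes A :: "'a::semiring_1 mat"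
  assumes A: "A \<in> carrier_mat n n" "upper_triangular A"
  shows "upper_triangular (A ^\<^sub>m k) \<and> (\<forall>i<n. (A ^\<^sub>m k) $$ (i, i) = A $$ (i, i) ^ k)"
proof (induction k)
  case 0
  show ?case using A by auto
next
  case (Suc k)
  have "A ^\<^sub>m k \<in> carrier_mat n n" using A by simp
  with Suc A show ?case
    using upper_triangular_mult[of "A ^\<^sub>m k" n A] by (simp add: power_commutes)
qed

lemma proots_prod_linear_factors:
  fixes as :: "'a::idom list"
  shows "proots (\<Prod>a\<leftarrow>as. [:- a, 1:]) = mset as"
proof (induction as)
  case (Cons a as)
  have "(\<Prod>a\<leftarrow>as. [:- a, 1:]) \<noteq> 0" by (auto simp: prod_list_zero_iff)
  thus ?case using Cons proots_mult[of "[:-a, 1:]" "\<Prod>a\<leftarrow>as. [:- a, 1:]"] by simp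
qed simp

text \<open>By Schur decomposition \<open>A\<close> is similar to an upper triangular
  \<open>B\<close> whose diagonal lists the eigenvalues with multiplicity. Similarity passes to
  \<open>k\<close>-th powers, and the diagonal of the \<open>k\<close>-th power of \<open>B\<close>
  consists of the \<open>k\<close>-th powers of its diagonal entries.\<close>

lemma trace_mat_pow_eq_power_sum:
  fixes A :: "complex mat"
  assumes A: "A \<in> carrier_mat n n"
  shows "trace_mat (A ^\<^sub>m k) = (\<Sum>z\<in>#proots (char_poly A). z ^ k)"
proof -
  obtain as where as: "char_poly A = (\<Prod>a\<leftarrow>as. [:- a, 1:])"
    using char_poly_factorized[OF A] by blast
  obtain B where B: "B \<in> carrier_mat n n" "upper_triangular B" "similar_mat A B"
    using schur_decomposition_exists[OF A as] by blast
  obtain P Q where PQ: "similar_mat_wit A B P Q"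
    using B(3) by (auto simp: similar_mat_def)
  have "char_poly A = (\<Prod>a\<leftarrow>diag_mat B. [:- a, 1:])"
    using char_poly_similar[OF B(3)] char_poly_upper_triangular[OF B(1,2)] by simp
  hence "proots (char_poly A) = mset (diag_mat B)"
    by (simp add: proots_prod_linear_factors)
  hence "(\<Sum>z\<in>#proots (char_poly A). z ^ k) = (\<Sum>i<n. B $$ (i, i) ^ k)"
    using B(1)
    by (simp add: diag_mat_def sum_mset_sum_list sum_list_distinct_conv_sum_set comp_def
        lessThan_atLeast0 flip: mset_map)
  also have "\<dots> = trace_mat (B ^\<^sub>m k)"
    using upper_triangular_pow[OF B(1,2), of k] B(1) by (simp add: trace_mat_def)
  also have "\<dots> = trace_mat (A ^\<^sub>m k)"
    using trace_mat_similar[OF similar_mat_wit_pow[OF PQ]] by simp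
  finally show ?thesis by simp
qed

text \<open>Makes the number of points readable from the spectrum: over the complex numbers the
  characteristic polynomial has as many roots, with multiplicity, as its degree.\<close>

lemma size_q_spectrum: "size (q_spectrum X xs q) = length xs"
proof -
  have "map_mat complex_of_real (similarity_matrix X xs q) \<in> carrier_mat (length xs) (length xs)"
    by (simp add: similarity_matrix_def)
  from degree_monic_char_poly[OF this] show ?thesis
    by (simp add: q_spectrum_def eigenvalue_mset_def size_proots_complex)
qed

lemma sum_nth_eq_sum_set:
  assumes "distinct xs"
  shows "(\<Sum>i<length xs. f (xs ! i)) = (\<Sum>x\<in>set xs. f x)"
  using sum.reindex_bij_betw[OF bij_betw_nth[OF assms refl refl], of f] .

lemma q_spectrum_power_sums:
  assumes "enumerates xs X"
  shows "(\<Sum>z\<in>#q_spectrum X xs q. z ^ 2) =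
           of_real (\<Sum>x\<in>mspace X. \<Sum>y\<in>mspace X. q powr mdist X x y * q powr mdist X y x)" (is ?th2)
    and "(\<Sum>z\<in>#q_spectrum X xs q. z ^ 3) =
           of_real (\<Sum>x\<in>mspace X. \<Sum>y\<in>mspace X. \<Sum>z\<in>mspace X.
             q powr mdist X x y * q powr mdist X y z * q powr mdist X z x)" (is ?th3)
proof -
  define n where "n = length xs"
  define A where "A = map_mat complex_of_real (similarity_matrix X xs q)"
  have xs: "distinct xs" "set xs = mspace X" using assms by (auto simp: enumerates_def)
  have A: "A \<in> carrier_mat n n" by (simp add: A_def n_def similarity_matrix_def)
  have ent: "A $$ (i, j) = of_real (q powr mdist X (xs ! i) (xs ! j))" if "i < n" "j < n" for i j
    using that by (simp add: A_def n_def similarity_matrix_def)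
  have spec: "q_spectrum X xs q = proots (char_poly A)"
    by (simp add: q_spectrum_def eigenvalue_mset_def A_def)
  have sq: "A ^\<^sub>m 2 = A * A" using A by (simp add: numeral_2_eq_2)
  have cb: "A ^\<^sub>m 3 = A * A * A" using A by (simp add: numeral_3_eq_3)
  have "trace_mat (A ^\<^sub>m 2) = (\<Sum>i<n. \<Sum>j<n. A $$ (i, j) * A $$ (j, i))"
    unfolding sq by (rule trace_mat_mult[OF A A])
  also have "\<dots> = of_real (\<Sum>i<length xs. \<Sum>j<length xs.
      q powr mdist X (xs ! i) (xs ! j) * q powr mdist X (xs ! j) (xs ! i))"
    by (auto simp: ent simp flip: n_def intro!: sum.cong)
  finally show ?th2
    unfolding spec trace_mat_pow_eq_power_sum[OF A] xs(2)[symmetric]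
      sum_nth_eq_sum_set[OF xs(1), symmetric] .
  have "trace_mat (A ^\<^sub>m 3) = (\<Sum>i<n. \<Sum>k<n. \<Sum>j<n. A $$ (i, j) * A $$ (j, k) * A $$ (k, i))"
    unfolding cb trace_mat_mult[OF mult_carrier_mat[OF A A] A]
    by (auto simp: mat_mult_entry[OF A A] sum_distrib_right intro!: sum.cong)
  also have "\<dots> = (\<Sum>i<n. \<Sum>j<n. \<Sum>k<n. A $$ (i, j) * A $$ (j, k) * A $$ (k, i))"
    by (intro sum.cong refl sum.swap)
  also have "\<dots> = of_real (\<Sum>i<length xs. \<Sum>j<length xs. \<Sum>k<length xs.
      q powr mdist X (xs ! i) (xs ! j) * q powr mdist X (xs ! j) (xs ! k) *
      q powr mdist X (xs ! k) (xs ! i))"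
    by (auto simp: ent simp flip: n_def intro!: sum.cong)
  finally show ?th3
    unfolding spec trace_mat_pow_eq_power_sum[OF A] xs(2)[symmetric]
      sum_nth_eq_sum_set[OF xs(1), symmetric] .
qed

section \<open>Linear independence of real powers\<close>

lemma tendsto_powr_at_right_0:
  assumes "0 < (e::real)"
  shows "((\<lambda>q. q powr e) \<longlongrightarrow> 0) (at_right 0)"
  using assms by (intro tendsto_zero_powrI[where b = e]) (auto intro: tendsto_ident_at eventually_mono[OF eventually_at_right_less])

text \<open>Divide by the power with the least exponent \<open>m\<close> and let \<open>q\<close>
  tend to 0 from the right. All remaining exponents \<open>s - m\<close> are positive, so their
  terms vanish in the limit and \<open>c m\<close> alone survives. The induction therefore adds
  exponents from below.\<close>

lemma powr_sum_eq_0_imp_coeff_eq_0: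
  fixes S :: "real set" and c :: "real \<Rightarrow> real"
  assumes "finite S" and "\<And>q. 0 < q \<Longrightarrow> q < 1 \<Longrightarrow> (\<Sum>s\<in>S. c s * q powr s) = 0"
  shows "\<forall>s\<in>S. c s = 0"
  using assms
proof (induction S rule: finite_linorder_min_induct)
  case (insert m S)
  have ev: "\<forall>\<^sub>F q in at_right (0::real). (\<Sum>s\<in>S. c s * q powr (s - m)) + c m = 0"
  proof -
    have "(\<Sum>s\<in>S. c s * q powr (s - m)) + c m = 0" if q: "q > 0" "q < 1" for q
    proof -
      have "(\<Sum>s\<in>S. c s * q powr (s - m)) + c m = (\<Sum>s\<in>insert m S. c s * q powr (s - m))"
        using insert.hyps q by (subst sum.insert) auto
      also have "\<dots> = (\<Sum>s\<in>insert m S. c s * q powr s) / q powr m"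
        by (simp add: powr_diff sum_divide_distrib)
      finally show ?thesis using insert.prems[OF q] by simp
    qed
    moreover have "\<forall>\<^sub>F q in at_right (0::real). 0 < q \<and> q < 1"
      unfolding eventually_at_right_field by (intro exI[of _ 1]) auto
    ultimately show ?thesis by (auto elim: eventually_mono)
  qed
  have "((\<lambda>q. (\<Sum>s\<in>S. c s * q powr (s - m)) + c m) \<longlongrightarrow> (\<Sum>s\<in>S. c s * 0) + c m) (at_right 0)"
    using insert.hyps by (intro tendsto_intros tendsto_powr_at_right_0) auto
  moreover have "((\<lambda>q. (\<Sum>s\<in>S. c s * q powr (s - m)) + c m) \<longlongrightarrow> 0) (at_right 0)"
    using ev by (simp add: tendsto_eventually)
  ultimately have cm: "c m = 0"
    using tendsto_unique[OF trivial_limit_at_right_real] by fastforce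
  have "(\<Sum>s\<in>S. c s * q powr s) = 0" if "0 < q" "q < 1" for q
    using insert.prems[OF that] insert.hyps cm by (subst (asm) sum.insert) auto
  from insert.IH[OF this] cm show ?case by simp
qed simp

text \<open>Grouping the terms by exponent turns the cardinalities of the fibres into coefficients,
  and these are determined by linear independence.\<close>

lemma powr_sums_eq_imp_card_eq:
  fixes a :: "'i \<Rightarrow> real" and b :: "'j \<Rightarrow> real"
  assumes fin: "finite I" "finite J"
    and eq: "\<And>q. 0 < q \<Longrightarrow> q < 1 \<Longrightarrow> (\<Sum>i\<in>I. q powr a i) = (\<Sum>j\<in>J. q powr b j)"
  shows "card {i\<in>I. a i = t} = card {j\<in>J. b j = t}"
proof -
  \<comment> \<open>Inserting \<open>t\<close> covers the case that \<open>t\<close> is not an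
    exponent on either side.\<close>
  define S where "S = insert t (a ` I \<union> b ` J)"
  define c where "c s = real (card {i\<in>I. a i = s}) - real (card {j\<in>J. b j = s})" for s
  have S: "finite S" "a ` I \<subseteq> S" "b ` J \<subseteq> S" using fin by (auto simp: S_def)
  have grp: "(\<Sum>k\<in>K. q powr h k) = (\<Sum>s\<in>S. real (card {k\<in>K. h k = s}) * q powr s)"
    if "finite K" "h ` K \<subseteq> S" for K and h :: "'k \<Rightarrow> real" and q
  proof -
    have "(\<Sum>k\<in>K. q powr h k) = (\<Sum>s\<in>S. \<Sum>k\<in>{k\<in>K. h k = s}. q powr h k)"
      by (rule sum.group[OF that(1) S(1) that(2), symmetric])
    thus ?thesis by simp
  qed
  have "(\<Sum>s\<in>S. c s * q powr s) = 0" if "0 < q" "q < 1" for q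
    using eq[OF that] grp[OF fin(1) S(2)] grp[OF fin(2) S(3)]
    by (simp add: c_def left_diff_distrib sum_subtractf)
  from powr_sum_eq_0_imp_coeff_eq_0[OF S(1) this] have "c t = 0" by (auto simp: S_def)
  thus ?thesis by (simp add: c_def)
qed

text \<open>Bijections \<open>f t\<close> between the fibres over each value \<open>t\<close> are
  glued together: \<open>i\<close> is sent through the one that belongs to its own value
  \<open>a i\<close>.\<close>

lemma bij_betw_if_card_fibres_eq:
  assumes fin: "finite I" "finite J"
    and eq: "\<And>t. card {i\<in>I. a i = t} = card {j\<in>J. b j = t}"
  shows "\<exists>\<phi>. bij_betw \<phi> I J \<and> (\<forall>i\<in>I. b (\<phi> i) = a i)"
proof -
  have "\<exists>f. bij_betw f {i\<in>I. a i = t} {j\<in>J. b j = t}" for t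
    using fin eq by (intro finite_same_card_bij) auto
  then obtain f where f: "\<And>t. bij_betw (f t) {i\<in>I. a i = t} {j\<in>J. b j = t}" by metis
  have 1: "f (a i) i \<in> J" "b (f (a i) i) = a i" if "i \<in> I" for i
    using bij_betwE[OF f[of "a i"]] that by auto
  have 2: "inj_on (\<lambda>i. f (a i) i) I"
  proof (rule inj_onI)
    fix x y assume xy: "x \<in> I" "y \<in> I" "f (a x) x = f (a y) y"
    with 1 have "a x = a y" by metis
    with xy bij_betw_imp_inj_on[OF f[of "a x"]] show "x = y" by (auto simp: inj_on_def)
  qed
  have 3: "j \<in> (\<lambda>i. f (a i) i) ` I" if "j \<in> J" for j
    using bij_betw_imp_surj_on[OF f[of "b j"]] that by force
  show ?thesis
    using 1 2 3 by (intro exI[of _ "\<lambda>i. f (a i) i"]) (auto simp: bij_betw_def)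
qed

section \<open>Edges and triangles of the complete graph\<close>

definition edges :: "'a set \<Rightarrow> 'a set set" where
  "edges A = {e. \<exists>x\<in>A. \<exists>y\<in>A. x \<noteq> y \<and> e = {x, y}}"

definition triangle_edges :: "'a \<Rightarrow> 'a \<Rightarrow> 'a \<Rightarrow> 'a set set" where
  "triangle_edges x y z = {{x, y}, {y, z}, {z, x}}"

text \<open>Ordered triples match the summation indices in the trace of the cube. Each triangle thus
  occurs six times, which is harmless because only the existence of a triangle with a given
  perimeter is extracted later.\<close>

definition triples :: "'a set \<Rightarrow> ('a \<times> 'a \<times> 'a) set" where
  "triples A = {(x, y, z). x \<in> A \<and> y \<in> A \<and> z \<in> A \<and> x \<noteq> y \<and> y \<noteq> z \<and> z \<noteq> x}"

text \<open>The double sum runs over ordered pairs, so each distance is counted twice.\<close>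

definition edge_length :: "'a metric \<Rightarrow> 'a set \<Rightarrow> real" where
  "edge_length X e = (\<Sum>x\<in>e. \<Sum>y\<in>e. mdist X x y) / 2"

lemma edgesI: "x \<in> A \<Longrightarrow> y \<in> A \<Longrightarrow> x \<noteq> y \<Longrightarrow> {x, y} \<in> edges A"
  by (auto simp: edges_def)

lemma edgesE:
  assumes "e \<in> edges A"
  obtains x y where "x \<in> A" "y \<in> A" "x \<noteq> y" "e = {x, y}"
  using assms by (auto simp: edges_def)

lemma finite_edges [intro]: "finite A \<Longrightarrow> finite (edges A)"
  by (rule finite_subset[of _ "Pow A"]) (auto simp: edges_def)

lemma finite_triples [intro]: "finite A \<Longrightarrow> finite (triples A)"
  by (rule finite_subset[of _ "A \<times> A \<times> A"]) (auto simp: triples_def)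

lemma triangle_edges_subset: "(x, y, z) \<in> triples A \<Longrightarrow> triangle_edges x y z \<subseteq> edges A"
  unfolding triples_def triangle_edges_def by (blast intro: edgesI)

lemma card_triangle_edges: "(x, y, z) \<in> triples A \<Longrightarrow> card (triangle_edges x y z) = 3"
  by (simp add: triples_def triangle_edges_def card_insert_if doubleton_eq_iff) metis

lemma mdist_self: "x \<in> mspace X \<Longrightarrow> mdist X x x = 0"
  by simp

lemma edge_length_pair:
  assumes "x \<in> mspace X" "y \<in> mspace X" "x \<noteq> y"
  shows "edge_length X {x, y} = mdist X x y"
  using assms by (simp add: edge_length_def mdist_self mdist_commute)

lemma sum_edge_length_triangle:
  assumes "(x, y, z) \<in> triples (mspace X)"
  shows "(\<Sum>e\<in>triangle_edges x y z. edge_length X e) = mdist X x y + mdist X y z + mdist X z x"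
  using assms
  by (auto simp: triples_def triangle_edges_def doubleton_eq_iff edge_length_pair)

section \<open>Edge bijections that preserve triangles\<close>

lemma obtain_third_vertices:
  assumes "finite A" "3 \<le> card A"
  obtains a b where "a \<in> A" "b \<in> A" "a \<noteq> b" "a \<noteq> v" "b \<noteq> v"
proof -
  have "2 \<le> card (A - {v})" using assms card_Diff_singleton_if[of A v] by auto
  then obtain S where "S \<subseteq> A - {v}" "card S = 2" by (rule obtain_subset_with_card_n)
  thus ?thesis using that by (auto simp: card_2_iff)
qed

text \<open>The vertex \<open>f v\<close> is the common point of the images of all edges at
  \<open>v\<close>. With at least three points there are two edges at \<open>v\<close>, and the
  intersection of their images determines this point.\<close>

lemma edge_map_induced_by_vertex_map:
  assumes fin: "finite A" "finite B" and card: "card A = card B" "3 \<le> card A"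
    and bij: "bij_betw \<phi> (edges A) (edges B)"
    and tri: "\<And>x y z. (x, y, z) \<in> triples A \<Longrightarrow>
                \<exists>x' y' z'. (x', y', z') \<in> triples B \<and> \<phi> ` triangle_edges x y z = triangle_edges x' y' z'"
  shows "\<exists>f. bij_betw f A B \<and> (\<forall>x\<in>A. \<forall>y\<in>A. x \<noteq> y \<longrightarrow> \<phi> {x, y} = {f x, f y})"
proof -
  have inj: "\<phi> e = \<phi> e' \<longleftrightarrow> e = e'" if "e \<in> edges A" "e' \<in> edges A" for e e'
    using that bij_betw_imp_inj_on[OF bij] by (auto simp: inj_on_def)
  have ran: "\<phi> e \<in> edges B" if "e \<in> edges A" for e
    using that bij_betwE[OF bij] by auto
  \<comment> \<open>Normal form for a triangle at \<open>v\<close>: the images of the two sides at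
    \<open>v\<close> share \<open>w\<close>, and the image of the opposite side joins their other
    ends \<open>p\<close> and \<open>r\<close>.\<close>
  have T: "\<exists>w p r. w \<in> B \<and> w \<noteq> p \<and> p \<noteq> r \<and> w \<noteq> r \<and> \<phi> {v, a} = {w, p} \<and> \<phi> {v, b} = {w, r} \<and> \<phi> {a, b} = {p, r}"
    if v: "v \<in> A" "a \<in> A" "b \<in> A" "v \<noteq> a" "v \<noteq> b" "a \<noteq> b" for v a b
  proof -
    have "(v, a, b) \<in> triples A" using v by (auto simp: triples_def)
    from tri[OF this] obtain x y z where xyz: "(x, y, z) \<in> triples B"
      and im: "\<phi> ` triangle_edges v a b = triangle_edges x y z" by blast
    have mem: "\<phi> {v, a} \<in> triangle_edges x y z" "\<phi> {v, b} \<in> triangle_edges x y z" "\<phi> {a, b} \<in> triangle_edges x y z"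
      unfolding im[symmetric] by (auto simp: triangle_edges_def insert_commute)
    have ne: "\<phi> {v, a} \<noteq> \<phi> {v, b}" "\<phi> {v, a} \<noteq> \<phi> {a, b}" "\<phi> {v, b} \<noteq> \<phi> {a, b}"
      using v by (auto simp: inj edgesI doubleton_eq_iff)
    \<comment> \<open>The six bijections between the sides of the two triangles, each written with
      the vertex that serves as \<open>w\<close> first.\<close>
    consider "\<phi> {v, a} = {x, y}" "\<phi> {v, b} = {x, z}" "\<phi> {a, b} = {y, z}"
      | "\<phi> {v, a} = {x, z}" "\<phi> {v, b} = {x, y}" "\<phi> {a, b} = {z, y}"
      | "\<phi> {v, a} = {y, x}" "\<phi> {v, b} = {y, z}" "\<phi> {a, b} = {x, z}"
      | "\<phi> {v, a} = {y, z}" "\<phi> {v, b} = {y, x}" "\<phi> {a, b} = {z, x}"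
      | "\<phi> {v, a} = {z, x}" "\<phi> {v, b} = {z, y}" "\<phi> {a, b} = {x, y}"
      | "\<phi> {v, a} = {z, y}" "\<phi> {v, b} = {z, x}" "\<phi> {a, b} = {y, x}"
      using mem ne unfolding triangle_edges_def
      by (elim insertE emptyE) (simp_all add: insert_commute)
    thus ?thesis
      using xyz unfolding triples_def by cases (simp; metis)+
  qed
  have "\<exists>w\<in>B. \<forall>c\<in>A. c \<noteq> v \<longrightarrow> w \<in> \<phi> {v, c}" if v: "v \<in> A" for v
  proof -
    obtain a b where ab: "a \<in> A" "b \<in> A" "a \<noteq> b" "a \<noteq> v" "b \<noteq> v"
      using obtain_third_vertices[OF fin(1) card(2)] by metis
    obtain w p r where w: "w \<in> B" "w \<noteq> p" "p \<noteq> r" "w \<noteq> r"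
      and im: "\<phi> {v, a} = {w, p}" "\<phi> {v, b} = {w, r}" "\<phi> {a, b} = {p, r}"
      using T[OF v ab(1,2)] ab by metis
    \<comment> \<open>An edge meeting \<open>{w, p}\<close> and \<open>{w, r}\<close> but missing \<open>w\<close> is \<open>{p, r}\<close>, the image of \<open>{a, b}\<close>.\<close>
    have "w \<in> \<phi> {v, c}" if c: "c \<in> A" "c \<noteq> v" for c
    proof (rule ccontr)
      assume nw: "w \<notin> \<phi> {v, c}"
      with im have ne: "c \<noteq> a" "c \<noteq> b" by auto
      \<comment> \<open>By \<open>T\<close> for \<open>v\<close>, \<open>a\<close>,
        \<open>c\<close>, the edge \<open>\<phi> {v, c}\<close> meets \<open>{w, p}\<close>; as
        \<open>w\<close> is excluded, they meet in \<open>p\<close>. The same argument with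
        \<open>b\<close> gives \<open>r\<close>.\<close>
      have "p \<in> \<phi> {v, c}" using T[OF v ab(1) c(1)] ab c ne nw im(1) by (auto simp: doubleton_eq_iff)
      moreover have "r \<in> \<phi> {v, c}" using T[OF v ab(2) c(1)] ab c ne nw im(2) by (auto simp: doubleton_eq_iff)
      moreover have "\<phi> {v, c} \<in> edges B" using v c by (intro ran edgesI) auto
      ultimately have "\<phi> {v, c} = \<phi> {a, b}" using w(3) im(3) by (auto elim!: edgesE)
      hence "{v, c} = {a, b}" using v c ab by (subst (asm) inj) (auto intro: edgesI)
      with ab show False by (auto simp: doubleton_eq_iff)
    qed
    with w(1) show ?thesis by blast
  qed
  hence "\<forall>v\<in>A. \<exists>w. w \<in> B \<and> (\<forall>c\<in>A. c \<noteq> v \<longrightarrow> w \<in> \<phi> {v, c})" by blast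
  from bchoice[OF this] obtain f
    where f: "\<And>v. v \<in> A \<Longrightarrow> f v \<in> B" "\<And>v c. v \<in> A \<Longrightarrow> c \<in> A \<Longrightarrow> c \<noteq> v \<Longrightarrow> f v \<in> \<phi> {v, c}"
    by blast
  have fne: "f v \<noteq> f a" if va: "v \<in> A" "a \<in> A" "v \<noteq> a" for v a
  proof
    assume eq: "f v = f a"
    obtain b where b: "b \<in> A" "b \<noteq> v" "b \<noteq> a"
      using obtain_third_vertices[OF fin(1) card(2), of v] by metis
    \<comment> \<open>If \<open>f v = f a\<close>, this point lies on the images of all three sides
      of the triangle \<open>v\<close>, \<open>a\<close>, \<open>b\<close>; but the sides of a
      triangle have no common vertex.\<close>
    have "f v \<in> \<phi> {v, a}" "f v \<in> \<phi> {v, b}" "f v \<in> \<phi> {a, b}"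
      using f(2)[of v a] f(2)[of v b] f(2)[of a b] eq va b by auto
    with T[OF va(1,2) b(1)] va b show False by auto
  qed
  have "inj_on f A" using fne by (auto simp: inj_on_def)
  moreover have "f ` A \<subseteq> B" using f(1) by auto
  ultimately have "bij_betw f A B"
    using card fin by (metis bij_betw_def card_image card_subset_eq)
  moreover have "\<phi> {x, y} = {f x, f y}" if xy: "x \<in> A" "y \<in> A" "x \<noteq> y" for x y
  proof -
    have "f x \<in> \<phi> {x, y}" "f y \<in> \<phi> {x, y}"
      using f(2)[of x y] f(2)[of y x] xy by (auto simp: insert_commute)
    moreover have "\<phi> {x, y} \<in> edges B" using xy by (intro ran edgesI)
    ultimately show ?thesis using fne[OF xy] by (auto elim!: edgesE)
  qed
  ultimately show ?thesis by blast
qed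

section \<open>The trace sums in terms of edges and triangles\<close>

text \<open>Each edge \<open>{x, y}\<close> arises from exactly two ordered pairs,
  \<open>(x, y)\<close> and \<open>(y, x)\<close>.\<close>

lemma sum_offdiagonal_eq_sum_edges:
  fixes g :: "'a set \<Rightarrow> real"
  assumes "finite A"
  shows "(\<Sum>x\<in>A. \<Sum>y\<in>A - {x}. g {x, y}) = 2 * (\<Sum>e\<in>edges A. g e)"
proof -
  let ?P = "Sigma A (\<lambda>x. A - {x})" and ?h = "\<lambda>(x, y). {x, y}"
  have "(\<Sum>x\<in>A. \<Sum>y\<in>A - {x}. g {x, y}) = (\<Sum>p\<in>?P. g (?h p))"
    using assms by (subst sum.Sigma) (auto intro!: sum.cong)
  also have "\<dots> = (\<Sum>e\<in>edges A. \<Sum>p\<in>{p\<in>?P. ?h p = e}. g (?h p))"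
    using assms by (intro sum.group[symmetric]) (auto intro: edgesI)
  also have "\<dots> = (\<Sum>e\<in>edges A. 2 * g e)"
  proof (rule sum.cong[OF refl])
    fix e assume "e \<in> edges A"
    then obtain x y where xy: "x \<in> A" "y \<in> A" "x \<noteq> y" "e = {x, y}" by (rule edgesE)
    hence "{p\<in>?P. ?h p = e} = {(x, y), (y, x)}" by (auto simp: doubleton_eq_iff)
    thus "(\<Sum>p\<in>{p\<in>?P. ?h p = e}. g (?h p)) = 2 * g e"
      using xy by (simp add: insert_commute)
  qed
  finally show ?thesis by (simp add: sum_distrib_left)
qed

text \<open>Every diagonal term equals 1, and by symmetry an off-diagonal term is \<open>q\<close>
  to twice the distance.\<close>

lemma sum_pairs_powr:
  assumes fin: "finite (mspace X)" and q: "0 < q"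
  shows "(\<Sum>x\<in>mspace X. \<Sum>y\<in>mspace X. q powr mdist X x y * q powr mdist X y x) =
           card (mspace X) + 2 * (\<Sum>e\<in>edges (mspace X). q powr (2 * edge_length X e))"
proof -
  have "(\<Sum>y\<in>mspace X. q powr mdist X x y * q powr mdist X y x) =
          1 + (\<Sum>y\<in>mspace X - {x}. q powr (2 * edge_length X {x, y}))" if x: "x \<in> mspace X" for x
  proof -
    have "q powr mdist X x y * q powr mdist X y x = q powr (2 * edge_length X {x, y})"
      if "y \<in> mspace X - {x}" for y
    proof -
      have "edge_length X {x, y} = mdist X x y" using x that by (intro edge_length_pair) auto
      thus ?thesis by (simp add: mdist_commute[of X y x] flip: powr_add)
    qed
    hence "(\<Sum>y\<in>mspace X - {x}. q powr mdist X x y * q powr mdist X y x) =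
        (\<Sum>y\<in>mspace X - {x}. q powr (2 * edge_length X {x, y}))"
      by (rule sum.cong[OF refl])
    thus ?thesis using x q by (simp add: mdist_self sum.remove[OF fin x])
  qed
  thus ?thesis
    using sum_offdiagonal_eq_sum_edges[OF fin, of "\<lambda>e. q powr (2 * edge_length X e)"]
    by (simp add: sum.distrib)
qed

text \<open>Inclusion-exclusion over the coincidences among \<open>x\<close>, \<open>y\<close> and \<open>z\<close>.\<close>

lemma sum_triples_powr:
  assumes fin: "finite (mspace X)" and q: "0 < q"
  shows "(\<Sum>(x, y, z)\<in>triples (mspace X). q powr (mdist X x y + mdist X y z + mdist X z x)) =
      (\<Sum>x\<in>mspace X. \<Sum>y\<in>mspace X. \<Sum>z\<in>mspace X.
         q powr mdist X x y * q powr mdist X y z * q powr mdist X z x)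
      - 3 * (\<Sum>x\<in>mspace X. \<Sum>y\<in>mspace X. q powr mdist X x y * q powr mdist X y x)
      + 2 * card (mspace X)"
proof -
  let ?A = "mspace X"
  define F where "F x y z = q powr mdist X x y * q powr mdist X y z * q powr mdist X z x" for x y z
  define G where "G x y = q powr mdist X x y * q powr mdist X y x" for x y
  \<comment> \<open>The condition \<open>y = x\<close> is independent of the innermost variable, so
    it is pulled out of the sum over \<open>z\<close> before the sum over \<open>y\<close>
    collapses.\<close>
  have diag: "(\<Sum>x\<in>?A. \<Sum>y\<in>?A. \<Sum>z\<in>?A. if y = x then G x z else 0) = (\<Sum>x\<in>?A. \<Sum>z\<in>?A. G x z)"
  proof (rule sum.cong[OF refl])
    fix x assume x: "x \<in> ?A"
    have "(\<Sum>y\<in>?A. \<Sum>z\<in>?A. if y = x then G x z else 0) =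
        (\<Sum>y\<in>?A. if y = x then \<Sum>z\<in>?A. G x z else 0)"
      by (intro sum.cong) auto
    thus "(\<Sum>y\<in>?A. \<Sum>z\<in>?A. if y = x then G x z else 0) = (\<Sum>z\<in>?A. G x z)"
      using fin x by simp
  qed
  have "(\<Sum>(x, y, z)\<in>triples ?A. q powr (mdist X x y + mdist X y z + mdist X z x)) =
        (\<Sum>(x, y, z)\<in>triples ?A. F x y z)"
    by (simp add: F_def powr_add)
  also have "\<dots> = (\<Sum>(x, y, z)\<in>?A \<times> ?A \<times> ?A. if x \<noteq> y \<and> y \<noteq> z \<and> z \<noteq> x then F x y z else 0)"
    using fin by (intro sum.mono_neutral_cong_left) (auto simp: triples_def)
  also have "\<dots> = (\<Sum>x\<in>?A. \<Sum>y\<in>?A. \<Sum>z\<in>?A. if x \<noteq> y \<and> y \<noteq> z \<and> z \<noteq> x then F x y z else 0)"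
    by (simp add: sum.cartesian_product)
  \<comment> \<open>If exactly two of the points coincide, \<open>F\<close> reduces to the
    \<open>G\<close> term subtracted for that coincidence. If all three coincide, the summand is
    \<open>1 - 3 + 2 = 0\<close>.\<close>
  also have "\<dots> = (\<Sum>x\<in>?A. \<Sum>y\<in>?A. \<Sum>z\<in>?A. F x y z - (if y = x then G x z else 0)
      - (if z = y then G x y else 0) - (if z = x then G x y else 0)
      + (if z = x then if y = x then 2 else 0 else 0))"
    using q by (intro sum.cong refl) (auto simp: F_def G_def mdist_self)
  also have "\<dots> = (\<Sum>x\<in>?A. \<Sum>y\<in>?A. \<Sum>z\<in>?A. F x y z)
      - 3 * (\<Sum>x\<in>?A. \<Sum>y\<in>?A. G x y) + 2 * card ?A"
    using fin by (simp add: sum.distrib sum_subtractf diag flip: sum_distrib_left)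
  finally show ?thesis by (simp add: F_def G_def)
qed

section \<open>Genericity and reconstruction of the metric\<close>

text \<open>Carries genericity from index pairs to edges: \<open>?h\<close> is a bijection between
  them that turns indexed distances into edge lengths.\<close>

lemma three_generic_edges:
  assumes enum: "enumerates xs X" and gen: "three_generic X xs"
    and E: "E \<subseteq> edges (mspace X)" "card E = 3" and E': "E' \<subseteq> edges (mspace X)" "card E' = 3"
    and eq: "(\<Sum>e\<in>E. edge_length X e) = (\<Sum>e\<in>E'. edge_length X e)"
  shows "E = E'"
proof -
  let ?I = "index_pairs (length xs)" and ?h = "\<lambda>(i, j). {xs ! i, xs ! j}"
  have xs: "distinct xs" "set xs = mspace X" using enum by (auto simp: enumerates_def)
  have inj: "inj_on ?h ?I"
    using xs(1) by (auto simp: inj_on_def index_pairs_def doubleton_eq_iff nth_eq_iff_index_eq)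
  have surj: "?h ` ?I = edges (mspace X)"
  proof
    show "?h ` ?I \<subseteq> edges (mspace X)"
      using xs(1) by (auto simp: index_pairs_def nth_eq_iff_index_eq simp flip: xs(2) intro!: edgesI)
    show "edges (mspace X) \<subseteq> ?h ` ?I"
    proof
      fix e assume "e \<in> edges (mspace X)"
      then obtain x y where "x \<in> set xs" "y \<in> set xs" "x \<noteq> y" "e = {x, y}"
        unfolding xs(2)[symmetric] by (rule edgesE)
      then obtain i j where ij: "i < length xs" "j < length xs" "i \<noteq> j" "e = {xs ! i, xs ! j}"
        by (metis in_set_conv_nth)
      hence "(i, j) \<in> ?I \<or> (j, i) \<in> ?I" by (auto simp: index_pairs_def)
      thus "e \<in> ?h ` ?I" using ij(4) by (force simp: insert_commute)
    qed
  qed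
  define pre where "pre E = {p\<in>?I. ?h p \<in> E}" for E
  have pre: "pre D \<subseteq> ?I" "?h ` pre D = D" "card (pre D) = card D"
     "(\<Sum>(i, j)\<in>pre D. mdist X (xs ! i) (xs ! j)) = (\<Sum>e\<in>D. edge_length X e)"
    if D: "D \<subseteq> edges (mspace X)" for D
  proof -
    show sub: "pre D \<subseteq> ?I" by (auto simp: pre_def)
    have injD: "inj_on ?h (pre D)" using inj sub by (rule inj_on_subset)
    show im: "?h ` pre D = D" using D unfolding pre_def surj[symmetric] by auto
    show "card (pre D) = card D" using card_image[OF injD] im by simp
    have "(\<Sum>e\<in>D. edge_length X e) = (\<Sum>p\<in>pre D. edge_length X (?h p))"
      using sum.reindex[OF injD, of "edge_length X"] im by (simp add: comp_def)
    also have "\<dots> = (\<Sum>(i, j)\<in>pre D. mdist X (xs ! i) (xs ! j))"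
      using sub xs(1)
      by (intro sum.cong)
         (auto simp: index_pairs_def edge_length_pair nth_eq_iff_index_eq simp flip: xs(2))
    finally show "(\<Sum>(i, j)\<in>pre D. mdist X (xs ! i) (xs ! j)) = (\<Sum>e\<in>D. edge_length X e)" ..
  qed
  have "pre E = pre E'"
  proof (rule ccontr)
    assume ne: "pre E \<noteq> pre E'"
    have "card (pre E) = 3" "card (pre E') = 3"
      by (simp_all only: pre(3)[OF E(1)] pre(3)[OF E'(1)] E(2) E'(2))
    from gen[unfolded three_generic_def, rule_format,
        OF pre(1)[OF E(1)] this(1) pre(1)[OF E'(1)] this(2) ne]
    show False unfolding pre(4)[OF E(1)] pre(4)[OF E'(1)] using eq by contradiction
  qed
  from arg_cong[OF this, of "image ?h"] show ?thesis
    unfolding pre(2)[OF E(1)] pre(2)[OF E'(1)] .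
qed

theorem theorem3p2:
  fixes X :: "'a metric" and X' :: "'b metric"
    and xs :: "'a list" and xs' :: "'b list"
  assumes "enumerates xs X" and "enumerates xs' X'"
    and "three_generic X xs" and "three_generic X' xs'"
    and "\<And>q :: real. 0 < q \<Longrightarrow> q < 1 \<Longrightarrow> q_spectrum X xs q = q_spectrum X' xs' q"
  shows "isometric X X'"
proof -
  let ?A = "mspace X" and ?B = "mspace X'"
  note spec = assms(5)
  have fin: "finite ?A" "finite ?B"
    using assms(1,2) by (metis enumerates_def finite_set)+
  have "length xs = length xs'"
    using spec[of "1/2"] size_q_spectrum[of X xs "1/2"] size_q_spectrum[of X' xs' "1/2"] by simp
  hence card: "card ?A = card ?B"
    using assms(1,2) by (metis enumerates_def distinct_card)
  have sum2: "(\<Sum>x\<in>?A. \<Sum>y\<in>?A. q powr mdist X x y * q powr mdist X y x) =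
      (\<Sum>x\<in>?B. \<Sum>y\<in>?B. q powr mdist X' x y * q powr mdist X' y x)" if "0 < q" "q < 1" for q
    using q_spectrum_power_sums(1)[OF assms(1), of q] q_spectrum_power_sums(1)[OF assms(2), of q]
    unfolding spec[OF that] of_real_eq_iff[where 'a = complex, symmetric] by simp
  have sum3: "(\<Sum>x\<in>?A. \<Sum>y\<in>?A. \<Sum>z\<in>?A. q powr mdist X x y * q powr mdist X y z * q powr mdist X z x) =
      (\<Sum>x\<in>?B. \<Sum>y\<in>?B. \<Sum>z\<in>?B. q powr mdist X' x y * q powr mdist X' y z * q powr mdist X' z x)"
    if "0 < q" "q < 1" for q
    using q_spectrum_power_sums(2)[OF assms(1), of q] q_spectrum_power_sums(2)[OF assms(2), of q]
    unfolding spec[OF that] of_real_eq_iff[where 'a = complex, symmetric] by simp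
  \<comment> \<open>The diagonal contributions are the numbers of points, which agree and
    cancel.\<close>
  have "(\<Sum>e\<in>edges ?A. q powr (2 * edge_length X e)) = (\<Sum>e\<in>edges ?B. q powr (2 * edge_length X' e))"
    if "0 < q" "q < 1" for q
    using sum2[OF that] sum_pairs_powr[OF fin(1) that(1)] sum_pairs_powr[OF fin(2) that(1)] card
    by simp
  \<comment> \<open>The exponents here are doubled lengths; the factor 2 is cancelled in
    \<open>len\<close>.\<close>
  note powr_sums_eq_imp_card_eq[OF finite_edges[OF fin(1)] finite_edges[OF fin(2)] this]
  from bij_betw_if_card_fibres_eq[OF finite_edges[OF fin(1)] finite_edges[OF fin(2)] this]
  obtain \<phi> where \<phi>: "bij_betw \<phi> (edges ?A) (edges ?B)"
    and len: "\<And>e. e \<in> edges ?A \<Longrightarrow> edge_length X' (\<phi> e) = edge_length X e"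
    by auto
  have perim: "card {p\<in>triples ?A. (\<lambda>(x, y, z). mdist X x y + mdist X y z + mdist X z x) p = t} =
      card {p\<in>triples ?B. (\<lambda>(x, y, z). mdist X' x y + mdist X' y z + mdist X' z x) p = t}" for t
  proof (rule powr_sums_eq_imp_card_eq)
    fix q :: real assume q: "0 < q" "q < 1"
    show "(\<Sum>i\<in>triples ?A. q powr (case i of (x, y, z) \<Rightarrow> mdist X x y + mdist X y z + mdist X z x)) =
      (\<Sum>j\<in>triples ?B. q powr (case j of (x, y, z) \<Rightarrow> mdist X' x y + mdist X' y z + mdist X' z x))"
      using sum_triples_powr[OF fin(1) q(1)] sum_triples_powr[OF fin(2) q(1)]
        sum2[OF q] sum3[OF q] card
      by (simp add: case_prod_beta)
  qed (rule finite_triples[OF fin(1)], rule finite_triples[OF fin(2)])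
  have tri: "\<exists>x' y' z'. (x', y', z') \<in> triples ?B \<and> \<phi> ` triangle_edges x y z = triangle_edges x' y' z'"
    if t: "(x, y, z) \<in> triples ?A" for x y z
  proof -
    let ?t = "mdist X x y + mdist X y z + mdist X z x"
    \<comment> \<open>The triple \<open>(x, y, z)\<close> witnesses that its fibre is nonempty; by
      \<open>perim\<close> the fibre of \<open>X'\<close> over the same perimeter is nonempty
      too.\<close>
    have "card {p\<in>triples ?A. (\<lambda>(x, y, z). mdist X x y + mdist X y z + mdist X z x) p = ?t} \<noteq> 0"
      using t finite_triples[OF fin(1)] by auto
    then obtain x' y' z' where t': "(x', y', z') \<in> triples ?B"
      and eq: "mdist X' x' y' + mdist X' y' z' + mdist X' z' x' = ?t"
      unfolding perim by (auto simp: card_eq_0_iff)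
    note sub = triangle_edges_subset[OF t]
    have inj: "inj_on \<phi> (triangle_edges x y z)"
      using bij_betw_imp_inj_on[OF \<phi>] sub by (rule inj_on_subset)
    \<comment> \<open>Both are sets of three edges of \<open>X'\<close> with total length
      \<open>?t\<close>, since \<phi> preserves lengths; genericity identifies them.\<close>
    have "\<phi> ` triangle_edges x y z = triangle_edges x' y' z'"
    proof (rule three_generic_edges[OF assms(2,4)])
      show "\<phi> ` triangle_edges x y z \<subseteq> edges ?B" using bij_betw_imp_surj_on[OF \<phi>] sub by blast
      show "card (\<phi> ` triangle_edges x y z) = 3" using card_image[OF inj] card_triangle_edges[OF t] by simp
      have "(\<Sum>e\<in>\<phi> ` triangle_edges x y z. edge_length X' e) = (\<Sum>e\<in>triangle_edges x y z. edge_length X e)"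
        using sub len by (subst sum.reindex[OF inj]) (auto intro!: sum.cong)
      thus "(\<Sum>e\<in>\<phi> ` triangle_edges x y z. edge_length X' e) = (\<Sum>e\<in>triangle_edges x' y' z'. edge_length X' e)"
        using sum_edge_length_triangle[OF t] sum_edge_length_triangle[OF t'] eq by simp
    qed (use triangle_edges_subset[OF t'] card_triangle_edges[OF t'] in auto)
    with t' show ?thesis by blast
  qed
  have "\<exists>f. bij_betw f ?A ?B \<and> (\<forall>x\<in>?A. \<forall>y\<in>?A. x \<noteq> y \<longrightarrow> \<phi> {x, y} = {f x, f y})"
  proof (cases "3 \<le> card ?A")
    case True
    show ?thesis by (rule edge_map_induced_by_vertex_map[OF fin card True \<phi> tri])
  next
    case False
    \<comment> \<open>With at most two points an edge can only be the whole space, so any bijection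
      of the points induces \<phi>.\<close>
    obtain f where f: "bij_betw f ?A ?B" using finite_same_card_bij[OF fin card] by blast
    have "\<phi> {x, y} = {f x, f y}" if xy: "x \<in> ?A" "y \<in> ?A" "x \<noteq> y" for x y
    proof -
      have "{x, y} \<in> edges ?A" using xy by (rule edgesI)
      hence "\<phi> {x, y} \<in> edges ?B" using bij_betwE[OF \<phi>] by blast
      hence "\<phi> {x, y} \<subseteq> ?B" "card (\<phi> {x, y}) = 2" by (auto elim!: edgesE)
      moreover have "f x \<noteq> f y" using f xy by (auto simp: bij_betw_def inj_on_def)
      hence "{f x, f y} \<subseteq> ?B" "card {f x, f y} = 2"
        using bij_betwE[OF f] xy by auto
      moreover have "card ?B \<le> 2" using False card by simp
      ultimately show ?thesis
        using card_seteq[OF fin(2), of "\<phi> {x, y}"] card_seteq[OF fin(2), of "{f x, f y}"] by simp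
    qed
    with f show ?thesis by blast
  qed
  then obtain f where f: "bij_betw f ?A ?B"
    and \<phi>f: "\<And>x y. x \<in> ?A \<Longrightarrow> y \<in> ?A \<Longrightarrow> x \<noteq> y \<Longrightarrow> \<phi> {x, y} = {f x, f y}" by blast
  have "mdist X' (f x) (f y) = mdist X x y" if xy: "x \<in> ?A" "y \<in> ?A" for x y
  proof (cases "x = y")
    case True
    thus ?thesis using xy bij_betwE[OF f] by (simp add: mdist_self)
  next
    case False
    have "f x \<in> ?B" "f y \<in> ?B" "f x \<noteq> f y"
      using f xy False by (auto simp: bij_betw_def inj_on_def)
    thus ?thesis
      using len[OF edgesI[OF xy False]] \<phi>f[OF xy False] xy False by (simp add: edge_length_pair)
  qed
  with f show ?thesis unfolding isometric_def by blast
qed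

end
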